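(* For all $\Delta \in \mathbb{N}$ (with $\Delta\ge 1$) and $\gamma \in \bigl(0, \frac{1}{2\Delta}\bigr)$, let $G$ be an $n$-vertex graph with minimum degree $\delta(G) \geq \bigl(\frac{2\Delta-1}{2\Delta} + \gamma \bigr)n$ and let $H$ be an $n$-vertex graph with maximum degree $\Delta(H) \leq \Delta$. Suppose $S \subseteq V(H)$ is a set of vertices of size $|S| \leq \gamma \Delta n$ and $\varphi_S: S \to V(G)$ is an embedding of the induced subgraph $H[S]$ into $G$. Then there exists an embedding $\varphi$ of $H$ into $G$ that extends the given embedding $\varphi_S$.
   Context: All graphs are simple and finite. An embedding of a graph $H$ into a graph $G$ is an injective map $\varphi:V(H)\to V(G)$ such that $\varphi(x)\varphi(y)\in E(G)$ for every edge $xy\in E(H)$. The map $\varphi$ extends $\varphi_S$ if its restriction to $S$ equals $\varphi_S$. *)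

theory Defs
  imports Complex_Main "Graph_Theory.Digraph_Component"
begin

text \<open>
  A finite simple undirected graph is a digraph in the locale \<^locale>\<open>graph\<close>: finite,
  loop-free, without parallel arcs, and with symmetric adjacency relation
  \<open>arcs_ends\<close>. Each undirected edge gives two opposite arcs, so the degree of a vertex in
  the undirected sense is its \<open>out_degree\<close>, not the sum of in- and out-degree.
  For the graph without vertices the two degree parameters below are 0, because
  the infimum and the supremum of the empty set of natural numbers are 0.
\<close>

definition min_degree :: "('a, 'b) pre_digraph \<Rightarrow> nat" where
  "min_degree G = (INF v\<in>verts G. out_degree G v)"

definition max_degree :: "('a, 'b) pre_digraph \<Rightarrow> nat" where
  "max_degree G = (SUP v\<in>verts G. out_degree G v)"

text \<open>
  Maps between vertex sets are total functions of which only the values on \<^term>\<open>verts H\<close>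
  matter.
\<close>

definition graph_embedding ::
  "('a \<Rightarrow> 'c) \<Rightarrow> ('a, 'b) pre_digraph \<Rightarrow> ('c, 'd) pre_digraph \<Rightarrow> bool" where
  "graph_embedding \<phi> H G \<longleftrightarrow>
     \<phi> ` verts H \<subseteq> verts G \<and> inj_on \<phi> (verts H) \<and>
     (\<forall>x y. (x, y) \<in> arcs_ends H \<longrightarrow> (\<phi> x, \<phi> y) \<in> arcs_ends G)"

end

theory Submission
  imports Defs "HOL-Combinatorics.Transposition"
begin

text \<open>
  The proof is a switching argument in the style of Sauer and Spencer. Since \<open>G\<close> and \<open>H\<close> have
  equally many vertices, \<open>\<phi>\<^sub>S\<close> extends to some bijection \<open>f\<close> from the vertices of \<open>H\<close> to those
  of \<open>G\<close>. Call an edge of \<open>H\<close> broken if \<open>f\<close> does not map it to an edge of \<open>G\<close>. No edge inside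
  \<open>S\<close> is broken, so a broken edge \<open>xy\<close> has an end outside \<open>S\<close>, say \<open>x\<close>. The number of broken edges
  goes down if the images of \<open>x\<close> and of a suitable vertex \<open>z\<close> outside \<open>S\<close> are exchanged
  (lemma \<open>broken_transpose\<close>). A vertex \<open>z\<close> is unsuitable only if it lies in \<open>S\<close>, if \<open>f z\<close> is a
  non-neighbour of \<open>f u\<close> for some neighbour \<open>u\<close> of \<open>x\<close>, or if \<open>z\<close> has a neighbour \<open>u\<close> for which
  \<open>f u\<close> is a non-neighbour of \<open>f x\<close>.

  If every vertex of \<open>G\<close> has at most \<open>d\<close> non-neighbours, itself included, each of the last two
  conditions excludes at most \<open>\<Delta> * d\<close> vertices. So a suitable \<open>z\<close> exists whenever
  \<open>2 * \<Delta> * d + card S < n\<close> (lemma \<open>exists_switching_vertex\<close>), and finitely many exchanges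
  repair all edges. In the situation of the theorem \<open>d \<le> (1 / (2 * \<Delta>) - \<gamma>) * n\<close> and
  \<open>card S \<le> \<gamma> * \<Delta> * n\<close>, so the left-hand side is at most \<open>n - \<gamma> * \<Delta> * n\<close>.
\<close>

section \<open>Repairing edges by switching\<close>

text \<open>
  The pairs of the relation \<open>R\<close> that \<open>f\<close> does not map into \<open>E\<close>. For symmetric \<open>R\<close> and \<open>E\<close> each
  broken edge appears in both directions.
\<close>

definition broken :: "('c \<times> 'c) set \<Rightarrow> ('a \<times> 'a) set \<Rightarrow> ('c \<Rightarrow> 'a) \<Rightarrow> ('c \<times> 'c) set" where
  "broken R E f = {(x, y) \<in> R. (f x, f y) \<notin> E}"

text \<open>
  The condition on the neighbours of \<open>x\<close> also guarantees that \<open>z\<close> is neither \<open>x\<close>, since \<open>xy\<close>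
  is broken, nor a neighbour of \<open>x\<close>, since \<open>E\<close> is irreflexive. So after the exchange every edge
  at \<open>x\<close> or \<open>z\<close> is mapped into \<open>E\<close>, and the other edges keep their images.
\<close>

lemma broken_transpose:
  assumes "sym R" and "irrefl R" and "sym E" and "irrefl E"
    and xy: "(x, y) \<in> broken R E f"
    and x_good: "\<forall>u\<in>R `` {x}. (f u, f z) \<in> E"
    and z_good: "\<forall>u\<in>R `` {z}. (f u, f x) \<in> E"
  shows "broken R E (f \<circ> transpose x z) \<subset> broken R E f"
proof -
  let ?g = "f \<circ> transpose x z"
  have Rxy: "(x, y) \<in> R" and not_E: "(f x, f y) \<notin> E"
    using xy by (auto simp: broken_def)
  have loops: "(v, v) \<notin> R" "(w, w) \<notin> E" for v w
    using \<open>irrefl R\<close> \<open>irrefl E\<close> by (auto simp: irrefl_def)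
  have "(x, z) \<notin> R"
    using x_good loops by blast
  then have "(z, x) \<notin> R"
    using \<open>sym R\<close> by (meson symD)
  have good_out: "(?g v, ?g u) \<in> E" if "(v, u) \<in> R" and "v = x \<or> v = z" for v u
  proof -
    have "u \<noteq> x" "u \<noteq> z"
      using that loops \<open>(x, z) \<notin> R\<close> \<open>(z, x) \<notin> R\<close> by auto
    moreover have "(f u, ?g v) \<in> E"
      using that x_good z_good by auto
    ultimately show ?thesis
      using \<open>sym E\<close> by (simp add: symD)
  qed
  have good: "(?g u, ?g v) \<in> E" if "(u, v) \<in> R" and "{u, v} \<inter> {x, z} \<noteq> {}" for u v
    using that good_out[of u v] good_out[of v u] \<open>sym R\<close> \<open>sym E\<close> by (auto dest: symD)
  have "broken R E ?g \<subseteq> broken R E f"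
  proof
    fix p assume "p \<in> broken R E ?g"
    then obtain u v where p: "p = (u, v)" "(u, v) \<in> R" "(?g u, ?g v) \<notin> E"
      by (auto simp: broken_def)
    then have "{u, v} \<inter> {x, z} = {}"
      using good by blast
    then show "p \<in> broken R E f"
      using p by (auto simp: broken_def)
  qed
  moreover have "(x, y) \<notin> broken R E ?g"
    using good[OF Rxy] by (auto simp: broken_def)
  ultimately show ?thesis
    using xy by blast
qed

lemma exists_switching_vertex:
  assumes "finite V" and bij: "bij_betw f V W"
    and R: "R \<subseteq> V \<times> V" "sym R" and "sym E"
    and deg: "\<forall>v\<in>V. card (R `` {v}) \<le> k"
    and non_nbrs: "\<forall>w\<in>W. card (W - E `` {w}) \<le> d"
    and "S \<subseteq> V" and small: "2 * k * d + card S < card V"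
    and "x \<in> V"
  obtains z where "z \<in> V - S"
    and "\<forall>u\<in>R `` {x}. (f u, f z) \<in> E" and "\<forall>u\<in>R `` {z}. (f u, f x) \<in> E"
proof -
  define N where "N u = {z \<in> V. (f u, f z) \<notin> E}" for u
  have fin: "finite (N u)" for u
    using \<open>finite V\<close> by (simp add: N_def)
  have finR: "finite (R `` {u})" for u
    using R \<open>finite V\<close> by (auto intro: finite_subset[of _ V])
  have N: "card (N u) \<le> d" if "u \<in> V" for u
  proof -
    have "card (N u) = card (f ` N u)"
      using bij by (intro card_image[symmetric]) (auto simp: N_def bij_betw_def inj_on_def)
    also have "\<dots> \<le> card (W - E `` {f u})"
      using bij \<open>finite V\<close> bij_betw_finite[OF bij]
      by (intro card_mono) (auto simp: N_def bij_betw_def)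
    also have "\<dots> \<le> d"
      using non_nbrs bij that by (auto simp: bij_betw_def)
    finally show ?thesis .
  qed
  let ?A = "\<Union>u\<in>R `` {x}. N u" and ?B = "\<Union>u\<in>N x. R `` {u}"
  have "card ?A \<le> (\<Sum>u\<in>R `` {x}. card (N u))"
    by (rule card_UN_le[OF finR])
  also have "\<dots> \<le> card (R `` {x}) * d"
    using N R by (intro sum_bounded_above[of _ _ d, simplified]) auto
  also have "\<dots> \<le> k * d"
    using deg \<open>x \<in> V\<close> by (intro mult_right_mono) auto
  finally have A: "card ?A \<le> k * d" .
  have "card ?B \<le> (\<Sum>u\<in>N x. card (R `` {u}))"
    by (rule card_UN_le[OF fin])
  also have "\<dots> \<le> card (N x) * k"
    using deg by (intro sum_bounded_above[of _ _ k, simplified]) (auto simp: N_def)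
  also have "\<dots> \<le> d * k"
    using N[OF \<open>x \<in> V\<close>] by (intro mult_right_mono) auto
  finally have B: "card ?B \<le> d * k" .
  have "card (?A \<union> ?B \<union> S) \<le> card ?A + card ?B + card S"
    by (meson add_le_mono1 card_Un_le le_trans)
  also have "\<dots> < card V"
    using A B small by (simp add: mult.commute)
  finally have "\<not> V \<subseteq> ?A \<union> ?B \<union> S"
    using fin finR finite_subset[OF \<open>S \<subseteq> V\<close> \<open>finite V\<close>]
    by (metis (no_types, lifting) card_mono finite_UN finite_Un not_le)
  then obtain z where z: "z \<in> V" "z \<notin> S" "z \<notin> ?A" "z \<notin> ?B"
    by blast
  have "\<forall>u\<in>R `` {x}. (f u, f z) \<in> E"
    using z by (auto simp: N_def)
  moreover have "\<forall>u\<in>R `` {z}. (f u, f x) \<in> E"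
    using z R \<open>sym E\<close> by (auto simp: N_def dest: symD)
  ultimately show ?thesis
    using that z by blast
qed

text \<open>
  Each exchange moves only vertices outside \<open>S\<close> and shrinks the set of broken edges, so the
  hypothesis that no edge inside \<open>S\<close> is broken survives the iteration.
\<close>

lemma exists_unbroken_bij:
  assumes "finite V" and bij: "bij_betw f V W"
    and R: "R \<subseteq> V \<times> V" "sym R" "irrefl R" and E: "sym E" "irrefl E"
    and deg: "\<forall>v\<in>V. card (R `` {v}) \<le> k"
    and non_nbrs: "\<forall>w\<in>W. card (W - E `` {w}) \<le> d"
    and "S \<subseteq> V" and small: "2 * k * d + card S < card V"
    and on_S: "broken R E f \<inter> S \<times> S = {}"
  shows "\<exists>g. bij_betw g V W \<and> (\<forall>x\<in>S. g x = f x) \<and> broken R E g = {}"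
  using bij on_S
proof (induction "card (broken R E f)" arbitrary: f rule: less_induct)
  case less
  show ?case
  proof (cases "broken R E f = {}")
    case True
    then show ?thesis
      using less.prems by blast
  next
    case False
    have "sym (broken R E f)"
      using R E by (auto simp: broken_def sym_def)
    moreover obtain a b where "(a, b) \<in> broken R E f"
      using False by auto
    moreover from this have "a \<notin> S \<or> b \<notin> S"
      using less.prems(2) by blast
    ultimately obtain x y where xy: "(x, y) \<in> broken R E f" and "x \<notin> S"
      by (meson symD)
    have "x \<in> V"
      using xy R by (auto simp: broken_def)
    obtain z where z: "z \<in> V - S"
      "\<forall>u\<in>R `` {x}. (f u, f z) \<in> E" "\<forall>u\<in>R `` {z}. (f u, f x) \<in> E"
      using exists_switching_vertex[OF \<open>finite V\<close> less.prems(1) R(1,2) E(1) deg non_nbrs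
          \<open>S \<subseteq> V\<close> small \<open>x \<in> V\<close>] .
    let ?g = "f \<circ> transpose x z"
    have fewer: "broken R E ?g \<subset> broken R E f"
      using broken_transpose[OF R(2,3) E xy z(2,3)] .
    have "finite (broken R E f)"
      using R(1) \<open>finite V\<close> by (rule_tac finite_subset[of _ "V \<times> V"]) (auto simp: broken_def)
    then have "card (broken R E ?g) < card (broken R E f)"
      using fewer by (rule psubset_card_mono)
    moreover have "bij_betw ?g V W"
      using less.prems(1) \<open>x \<in> V\<close> z(1)
      by (intro bij_betw_trans[of _ V V]) (auto simp: bij_betw_transpose_iff)
    moreover have "broken R E ?g \<inter> S \<times> S = {}"
      using fewer less.prems(2) by blast
    ultimately obtain h where "bij_betw h V W" "\<forall>v\<in>S. h v = ?g v" "broken R E h = {}"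
      using less.hyps by blast
    moreover have "\<forall>v\<in>S. ?g v = f v"
      using \<open>x \<notin> S\<close> z(1) by (auto simp: transpose_def)
    ultimately show ?thesis
      by auto
  qed
qed

section \<open>The starting bijection\<close>

lemma inj_on_extends_to_bij_betw:
  assumes "finite V" and "finite W" and "card V = card W"
    and "S \<subseteq> V" and "inj_on g S" and "g ` S \<subseteq> W"
  obtains f where "bij_betw f V W" and "\<forall>x\<in>S. f x = g x"
proof -
  have "finite S"
    using assms finite_subset by blast
  then have "card (V - S) = card (W - g ` S)"
    using assms by (simp add: card_Diff_subset card_image)
  then obtain h where h: "bij_betw h (V - S) (W - g ` S)"
    using assms by (meson finite_Diff finite_same_card_bij)
  let ?f = "\<lambda>x. if x \<in> S then g x else h x"
  have "bij_betw ?f (S \<union> (V - S)) (g ` S \<union> (W - g ` S))"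
  proof (rule bij_betw_combine)
    show "bij_betw ?f S (g ` S)"
      using \<open>inj_on g S\<close> by (auto simp: bij_betw_def inj_on_def)
    show "bij_betw ?f (V - S) (W - g ` S)"
      using h by (subst bij_betw_cong[of _ _ h]) auto
  qed auto
  then have "bij_betw ?f V W"
    using assms by (simp add: Un_absorb1)
  then show ?thesis
    using that by auto
qed

section \<open>Degrees in terms of adjacency\<close>

lemma arcs_ends_induce_subgraph:
  "arcs_ends (G \<restriction> S) = arcs_ends G \<inter> S \<times> S"
  by (auto simp: arcs_ends_conv)

lemma arcs_ends_Image_eq:
  "arcs_ends G `` {v} = head G ` out_arcs G v"
  by (auto simp: arcs_ends_conv)

lemma (in fin_digraph) card_arcs_ends_Image_le_max_degree:
  assumes "v \<in> verts G"
  shows "card (arcs_ends G `` {v}) \<le> max_degree G"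
proof -
  have "card (arcs_ends G `` {v}) \<le> out_degree G v"
    unfolding arcs_ends_Image_eq out_degree_def by (intro card_image_le finite_out_arcs)
  also have "\<dots> \<le> max_degree G"
    unfolding max_degree_def using assms by (intro cSUP_upper) auto
  finally show ?thesis .
qed

lemma (in digraph) min_degree_le_card_arcs_ends_Image:
  assumes "v \<in> verts G"
  shows "min_degree G \<le> card (arcs_ends G `` {v})"
proof -
  have "inj_on (head G) (out_arcs G v)"
    by (auto simp: inj_on_def arc_to_ends_def intro: no_multi_arcs)
  then have "card (arcs_ends G `` {v}) = out_degree G v"
    unfolding arcs_ends_Image_eq out_degree_def by (rule card_image)
  moreover have "min_degree G \<le> out_degree G v"
    unfolding min_degree_def using assms by (intro cINF_lower) auto
  ultimately show ?thesis
    by simp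
qed

lemma (in loopfree_digraph) irrefl_arcs_ends: "irrefl (arcs_ends G)"
  using adj_not_same by (auto simp: irrefl_def)

section \<open>Extending the partial embedding\<close>

theorem lemma3p1:
  fixes \<Delta> n :: nat and \<gamma> :: real
    and G :: "('a, 'b) pre_digraph" and H :: "('c, 'd) pre_digraph"
    and S :: "'c set" and \<phi>\<^sub>S :: "'c \<Rightarrow> 'a"
  assumes "\<Delta> \<ge> 1"
    and "0 < \<gamma>" and "\<gamma> < 1 / (2 * real \<Delta>)"
    and "graph G" and "card (verts G) = n"
    and "real (min_degree G) \<ge> ((2 * real \<Delta> - 1) / (2 * real \<Delta>) + \<gamma>) * real n"
    and "graph H" and "card (verts H) = n"
    and "max_degree H \<le> \<Delta>"
    and "S \<subseteq> verts H" and "real (card S) \<le> \<gamma> * real \<Delta> * real n"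
    and "graph_embedding \<phi>\<^sub>S (H \<restriction> S) G"
  shows "\<exists>\<phi>. graph_embedding \<phi> H G \<and> (\<forall>x\<in>S. \<phi> x = \<phi>\<^sub>S x)"
proof (cases "n = 0")
  case True
  interpret H: graph H by fact
  have "verts H = {}"
    using True assms(8) by simp
  then have "S = {}" "arcs_ends H = {}"
    using assms(10) H.adj_in_verts by auto
  then show ?thesis
    using \<open>verts H = {}\<close> by (simp add: graph_embedding_def)
next
  case False
  interpret G: graph G by fact
  interpret H: graph H by fact
  let ?V = "verts H" and ?W = "verts G" and ?R = "arcs_ends H" and ?E = "arcs_ends G"
  define d where "d = n - min_degree G"
  have non_nbrs: "\<forall>w\<in>?W. card (?W - ?E `` {w}) \<le> d"
  proof
    fix w assume w: "w \<in> ?W"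
    have sub: "?E `` {w} \<subseteq> ?W"
      using G.adj_in_verts by auto
    then have "card (?W - ?E `` {w}) = n - card (?E `` {w})"
      using assms(5) by (simp add: card_Diff_subset finite_subset)
    then show "card (?W - ?E `` {w}) \<le> d"
      using G.min_degree_le_card_arcs_ends_Image[OF w] by (simp add: d_def)
  qed
  have deg: "\<forall>v\<in>?V. card (?R `` {v}) \<le> \<Delta>"
    using H.card_arcs_ends_Image_le_max_degree assms(9) le_trans by blast

  have "real d \<le> (1 / (2 * real \<Delta>) - \<gamma>) * real n"
  proof (cases "min_degree G \<le> n")
    case True
    then have "real d = real n - real (min_degree G)"
      by (simp add: d_def)
    moreover have "(2 * real \<Delta> - 1) / (2 * real \<Delta>) = 1 - 1 / (2 * real \<Delta>)"
      using assms(1) by (simp add: diff_divide_distrib)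
    then have "real (min_degree G) \<ge> (1 - 1 / (2 * real \<Delta>) + \<gamma>) * real n"
      using assms(6) by simp
    ultimately show ?thesis
      by (simp add: ring_distribs)
  next
    case False
    then show ?thesis
      using assms(3) by (simp add: d_def)
  qed
  then have "2 * real \<Delta> * real d \<le> 2 * real \<Delta> * ((1 / (2 * real \<Delta>) - \<gamma>) * real n)"
    by (intro mult_left_mono) auto
  also have "\<dots> = real n - 2 * (\<gamma> * real \<Delta> * real n)"
    using assms(1) by (simp add: field_simps)
  finally have "2 * real \<Delta> * real d + real (card S) \<le> real n - \<gamma> * real \<Delta> * real n"
    using assms(11) by linarith
  also have "\<dots> < real n"
    using assms(1,2) False by simp
  finally have "real (2 * \<Delta> * d + card S) < real (card ?V)"
    using assms(8) by simp
  then have small: "2 * \<Delta> * d + card S < card ?V"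
    by (simp only: of_nat_less_iff)

  have \<phi>S: "\<phi>\<^sub>S ` S \<subseteq> ?W" "inj_on \<phi>\<^sub>S S"
    and \<phi>S_edges: "\<And>x y. (x, y) \<in> ?R \<inter> S \<times> S \<Longrightarrow> (\<phi>\<^sub>S x, \<phi>\<^sub>S y) \<in> ?E"
    using assms(12) by (simp_all add: graph_embedding_def arcs_ends_induce_subgraph)
  obtain f where f: "bij_betw f ?V ?W" "\<forall>x\<in>S. f x = \<phi>\<^sub>S x"
    using inj_on_extends_to_bij_betw[of ?V ?W S \<phi>\<^sub>S] assms(5,8,10) \<phi>S by auto
  have on_S: "broken ?R ?E f \<inter> S \<times> S = {}"
    using \<phi>S_edges f(2) by (auto simp: broken_def)
  have "?R \<subseteq> ?V \<times> ?V"
    using H.adj_in_verts by auto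
  then obtain g where g: "bij_betw g ?V ?W" "\<forall>x\<in>S. g x = f x" "broken ?R ?E g = {}"
    using exists_unbroken_bij[OF _ f(1) _ _ _ _ _ deg non_nbrs assms(10) small on_S]
      G.sym_arcs H.sym_arcs G.irrefl_arcs_ends H.irrefl_arcs_ends
    by (auto simp: symmetric_def)
  have "graph_embedding g H G"
    using g(1,3) by (auto simp: graph_embedding_def bij_betw_def broken_def)
  then show ?thesis
    using f(2) g(2) by auto
qed

end
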